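(* Consider the robust access allocation problem (R) defined in the context, with a primal-dual optimal solution (denoted by $\star$), access prices $\overline{\boldsymbol\lambda}^\star,\underline{\boldsymbol\lambda}^\star$, payments $\mathcal P_k=\overline{\boldsymbol\lambda}^{\star\top}\overline{\mathbf C}_k^\star+\underline{\boldsymbol\lambda}^{\star\top}\underline{\mathbf C}_k^\star$, and surpluses $$\Pi^{\mathrm{DSO}}:=\sum_{k=1}^K\mathcal P_k-\big(J(\overline{\mathbf P}^\star,\underline{\mathbf P}^\star)-J(\overline{\mathbf p}_0,\underline{\mathbf p}_0)\big),\qquad \Pi_k^{\mathrm{DERA}}:=\varphi_k(\underline{\mathbf C}_k^\star,\overline{\mathbf C}_k^\star)-\mathcal P_k .$$ Then: (i) $\Pi^{\mathrm{DSO}}\ge0$. (ii) For each $k$, $\Pi_k^{\mathrm{DERA}}\ge0$ if $\varphi_k(\mathbf 0,\mathbf 0)\ge0$ and one of the following two conditions holds: (a) $\overline{\mathbf C}_k^{\min}=\mathbf 0$ and $\underline{\mathbf C}_k^{\min}=\mathbf 0$; or (b) the minimum access constraints are non-binding at optimality, i.e., $\overline{\mathbf C}_k^\star>\overline{\mathbf C}_k^{\min}$ and $\underline{\mathbf C}_k^\star>\underline{\mathbf C}_k^{\min}$ (element-wise).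
   Context: All vector inequalities are element-wise. For a scalar $z$, $z_+:=\max\{z,0\}$, $z_-:=z_+-z$, applied element-wise to matrices, so $\mathbf A=\mathbf A_+-\mathbf A_-$. Problem (R). Data: positive integers $K,N,M$; $\mathbf A\in\mathbb{R}^{M\times N}$; $\underline{\mathbf b},\overline{\mathbf b}\in\mathbb{R}^M$; element-wise nonnegative $\overline{\mathbf C}_k^{\min},\underline{\mathbf C}_k^{\min},\overline{\mathbf P}^{\max},\underline{\mathbf P}^{\max}\in\mathbb{R}^N$; $\overline{\mathbf p}_0,\underline{\mathbf p}_0\in\mathbb{R}^N$ with $-\underline{\mathbf p}_0\le\overline{\mathbf p}_0$; concave non-decreasing $\varphi_k:\mathbb{R}^{2N}\to\mathbb{R}$, $k=1,\dots,K$; convex non-decreasing $J:\mathbb{R}^{2N}\to\mathbb{R}$. Over $\overline{\mathbf C}_k,\underline{\mathbf C}_k,\overline{\mathbf P},\underline{\mathbf P}\in\mathbb{R}^N$, maximize $\sum_{k=1}^K\varphi_k(\underline{\mathbf C}_k,\overline{\mathbf C}_k)-J(\overline{\mathbf P},\underline{\mathbf P})$ subject to (multipliers in brackets) - $[\overline{\boldsymbol\eta}_k,\underline{\boldsymbol\eta}_k\ge0]$: $\overline{\mathbf C}_k^{\min}\le\overline{\mathbf C}_k$, $\underline{\mathbf C}_k^{\min}\le\underline{\mathbf C}_k$ for each $k$ (the minimum access constraints); - $[\overline{\boldsymbol\omega},\underline{\boldsymbol\omega}\ge0]$: $\overline{\mathbf P}\le\overline{\mathbf P}^{\max}$, $\underline{\mathbf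 P}\le\underline{\mathbf P}^{\max}$; - $[\overline{\boldsymbol\lambda},\underline{\boldsymbol\lambda}\text{ free}]$: $\overline{\mathbf P}=\sum_k\overline{\mathbf C}_k+\overline{\mathbf p}_0$, $\underline{\mathbf P}=\sum_k\underline{\mathbf C}_k+\underline{\mathbf p}_0$; - $[\overline{\boldsymbol\mu}\ge0]$: $\mathbf A_+\overline{\mathbf P}+\mathbf A_-\underline{\mathbf P}\le\overline{\mathbf b}$; - $[\underline{\boldsymbol\mu}\ge0]$: $\underline{\mathbf b}\le-\mathbf A_+\underline{\mathbf P}-\mathbf A_-\overline{\mathbf P}$. The Lagrangian (sign convention) is $$\mathcal L=J(\overline{\mathbf P},\underline{\mathbf P})-\sum_k\varphi_k(\underline{\mathbf C}_k,\overline{\mathbf C}_k)+\overline{\boldsymbol\lambda}^\top\Big(\sum_k\overline{\mathbf C}_k+\overline{\mathbf p}_0-\overline{\mathbf P}\Big)+\underline{\boldsymbol\lambda}^\top\Big(\sum_k\underline{\mathbf C}_k+\underline{\mathbf p}_0-\underline{\mathbf P}\Big)+\sum_k\overline{\boldsymbol\eta}_k^\top(\overline{\mathbf C}_k^{\min}-\overline{\mathbf C}_k)+\sum_k\underline{\boldsymbol\eta}_k^\top(\underline{\mathbf C}_k^{\min}-\underline{\mathbf C}_k)$$ $$+\overline{\boldsymbol\mu}^\top(\mathbf A_+\overline{\mathbf P}+\mathbf A_-\underline{\mathbf P}-\overline{\mathbf b})+\underline{\boldsymbol\mu}^\top(\mathbf A_+\underline{\mathbf P}+\mathbf A_-\overline{\mathbf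 P}+\underline{\mathbf b})+\overline{\boldsymbol\omega}^\top(\overline{\mathbf P}-\overline{\mathbf P}^{\max})+\underline{\boldsymbol\omega}^\top(\underline{\mathbf P}-\underline{\mathbf P}^{\max}).$$ A primal-dual optimal solution means: the primal point is feasible, the inequality multipliers are nonnegative, complementary slackness holds for every inequality constraint, and the primal point minimizes $\mathcal L$ (at the given multipliers) over all $\overline{\mathbf C}_k,\underline{\mathbf C}_k,\overline{\mathbf P},\underline{\mathbf P}\in\mathbb{R}^N$. The access prices (LMAP-R) are the components $\overline{\boldsymbol\lambda}^\star,\underline{\boldsymbol\lambda}^\star$. *)

theory Defs
  imports "HOL-Analysis.Analysis"
begin

definition pos_part :: "real \<Rightarrow> real" where
  "pos_part z = max z 0"

definition neg_part :: "real \<Rightarrow> real" where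
  "neg_part z = pos_part z - z"

definition mat_pos :: "real^'n^'m \<Rightarrow> real^'n^'m" where
  "mat_pos B = (\<chi> i j. pos_part (B $ i $ j))"

definition mat_neg :: "real^'n^'m \<Rightarrow> real^'n^'m" where
  "mat_neg B = (\<chi> i j. neg_part (B $ i $ j))"

text \<open>The suffixes \<open>_up\<close> and \<open>_lo\<close> stand for overlined and underlined symbols. The
  cardinalities of the index types \<open>'m\<close>, \<open>'n\<close>, \<open>'k\<close> are the positive integers M, N, K,
  and functions on 2N-dimensional space take pairs of vectors. The two arguments of
  \<open>phi R k\<close> come in the order (lower, upper), those of \<open>J R\<close> in the order (upper, lower).\<close>

record ('m::finite, 'n::finite, 'k::finite) access_problem =
  Amat :: "real^'n^'m"
  b_lo :: "real^'m"
  b_up :: "real^'m"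
  Cmin_up :: "'k \<Rightarrow> real^'n"
  Cmin_lo :: "'k \<Rightarrow> real^'n"
  Pmax_up :: "real^'n"
  Pmax_lo :: "real^'n"
  p0_up :: "real^'n"
  p0_lo :: "real^'n"
  phi :: "'k \<Rightarrow> (real^'n) \<times> (real^'n) \<Rightarrow> real"
  J :: "(real^'n) \<times> (real^'n) \<Rightarrow> real"

record ('n::finite, 'k::finite) primal_point =
  C_up :: "'k \<Rightarrow> real^'n"
  C_lo :: "'k \<Rightarrow> real^'n"
  P_up :: "real^'n"
  P_lo :: "real^'n"

record ('m::finite, 'n::finite, 'k::finite) multipliers =
  lam_up :: "real^'n"
  lam_lo :: "real^'n"
  eta_up :: "'k \<Rightarrow> real^'n"
  eta_lo :: "'k \<Rightarrow> real^'n"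
  mu_up :: "real^'m"
  mu_lo :: "real^'m"
  omega_up :: "real^'n"
  omega_lo :: "real^'n"

text \<open>Here \<open>\<le>\<close> on vectors and on pairs of vectors is the component-wise order, so \<open>mono\<close>
  is element-wise monotonicity in all 2N coordinates.\<close>

definition admissible_data :: "('m::finite, 'n::finite, 'k::finite) access_problem \<Rightarrow> bool" where
  "admissible_data R \<longleftrightarrow>
     (\<forall>k. 0 \<le> Cmin_up R k \<and> 0 \<le> Cmin_lo R k) \<and>
     0 \<le> Pmax_up R \<and> 0 \<le> Pmax_lo R \<and>
     - p0_lo R \<le> p0_up R \<and>
     (\<forall>k. concave_on UNIV (phi R k) \<and> mono (phi R k)) \<and>
     convex_on UNIV (J R) \<and> mono (J R)"

definition objective ::
  "('m::finite, 'n::finite, 'k::finite) access_problem \<Rightarrow> ('n, 'k) primal_point \<Rightarrow> real" where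
  "objective R x = (\<Sum>k\<in>UNIV. phi R k (C_lo x k, C_up x k)) - J R (P_up x, P_lo x)"

definition feasible ::
  "('m::finite, 'n::finite, 'k::finite) access_problem \<Rightarrow> ('n, 'k) primal_point \<Rightarrow> bool" where
  "feasible R x \<longleftrightarrow>
     (\<forall>k. Cmin_up R k \<le> C_up x k \<and> Cmin_lo R k \<le> C_lo x k) \<and>
     P_up x \<le> Pmax_up R \<and> P_lo x \<le> Pmax_lo R \<and>
     P_up x = (\<Sum>k\<in>UNIV. C_up x k) + p0_up R \<and>
     P_lo x = (\<Sum>k\<in>UNIV. C_lo x k) + p0_lo R \<and>
     mat_pos (Amat R) *v P_up x + mat_neg (Amat R) *v P_lo x \<le> b_up R \<and>
     b_lo R \<le> - (mat_pos (Amat R) *v P_lo x) - mat_neg (Amat R) *v P_up x"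

definition lagrangian ::
  "('m::finite, 'n::finite, 'k::finite) access_problem \<Rightarrow> ('m, 'n, 'k) multipliers \<Rightarrow>
   ('n, 'k) primal_point \<Rightarrow> real" where
  "lagrangian R y x =
     - objective R x
     + lam_up y \<bullet> ((\<Sum>k\<in>UNIV. C_up x k) + p0_up R - P_up x)
     + lam_lo y \<bullet> ((\<Sum>k\<in>UNIV. C_lo x k) + p0_lo R - P_lo x)
     + (\<Sum>k\<in>UNIV. eta_up y k \<bullet> (Cmin_up R k - C_up x k))
     + (\<Sum>k\<in>UNIV. eta_lo y k \<bullet> (Cmin_lo R k - C_lo x k))
     + mu_up y \<bullet> (mat_pos (Amat R) *v P_up x + mat_neg (Amat R) *v P_lo x - b_up R)
     + mu_lo y \<bullet> (mat_pos (Amat R) *v P_lo x + mat_neg (Amat R) *v P_up x + b_lo R)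
     + omega_up y \<bullet> (P_up x - Pmax_up R)
     + omega_lo y \<bullet> (P_lo x - Pmax_lo R)"

definition dual_feasible :: "('m::finite, 'n::finite, 'k::finite) multipliers \<Rightarrow> bool" where
  "dual_feasible y \<longleftrightarrow>
     (\<forall>k. 0 \<le> eta_up y k \<and> 0 \<le> eta_lo y k) \<and>
     0 \<le> mu_up y \<and> 0 \<le> mu_lo y \<and>
     0 \<le> omega_up y \<and> 0 \<le> omega_lo y"

definition complementary_slackness ::
  "('m::finite, 'n::finite, 'k::finite) access_problem \<Rightarrow> ('n, 'k) primal_point \<Rightarrow>
   ('m, 'n, 'k) multipliers \<Rightarrow> bool" where
  "complementary_slackness R x y \<longleftrightarrow>
     (\<forall>k i. eta_up y k $ i * (Cmin_up R k - C_up x k) $ i = 0) \<and>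
     (\<forall>k i. eta_lo y k $ i * (Cmin_lo R k - C_lo x k) $ i = 0) \<and>
     (\<forall>i. omega_up y $ i * (P_up x - Pmax_up R) $ i = 0) \<and>
     (\<forall>i. omega_lo y $ i * (P_lo x - Pmax_lo R) $ i = 0) \<and>
     (\<forall>j. mu_up y $ j *
        (mat_pos (Amat R) *v P_up x + mat_neg (Amat R) *v P_lo x - b_up R) $ j = 0) \<and>
     (\<forall>j. mu_lo y $ j *
        (mat_pos (Amat R) *v P_lo x + mat_neg (Amat R) *v P_up x + b_lo R) $ j = 0)"

definition primal_dual_optimal ::
  "('m::finite, 'n::finite, 'k::finite) access_problem \<Rightarrow> ('n, 'k) primal_point \<Rightarrow>
   ('m, 'n, 'k) multipliers \<Rightarrow> bool" where
  "primal_dual_optimal R x y \<longleftrightarrow>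
     feasible R x \<and> dual_feasible y \<and> complementary_slackness R x y \<and>
     (\<forall>x'. lagrangian R y x \<le> lagrangian R y x')"

definition payment ::
  "('n::finite, 'k::finite) primal_point \<Rightarrow> ('m::finite, 'n, 'k) multipliers \<Rightarrow> 'k \<Rightarrow> real" where
  "payment x y k = lam_up y \<bullet> C_up x k + lam_lo y \<bullet> C_lo x k"

definition dso_surplus ::
  "('m::finite, 'n::finite, 'k::finite) access_problem \<Rightarrow> ('n, 'k) primal_point \<Rightarrow>
   ('m, 'n, 'k) multipliers \<Rightarrow> real" where
  "dso_surplus R x y =
     (\<Sum>k\<in>UNIV. payment x y k) - (J R (P_up x, P_lo x) - J R (p0_up R, p0_lo R))"

definition dera_surplus ::
  "('m::finite, 'n::finite, 'k::finite) access_problem \<Rightarrow> ('n, 'k) primal_point \<Rightarrow>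
   ('m, 'n, 'k) multipliers \<Rightarrow> 'k \<Rightarrow> real" where
  "dera_surplus R x y k = phi R k (C_lo x k, C_up x k) - payment x y k"

end

theory Submission
  imports Defs
begin

text \<open>Both claims compare the primal-dual optimum with one deviation in the Lagrangian. Moving
  \<open>(P_up, P_lo)\<close> to \<open>(p0_up, p0_lo)\<close> bounds the increase of \<open>J\<close> by the payments
  minus terms pairing nonnegative multipliers with the total allocated access, which is itself
  nonnegative. Moving the access of a single \<open>k\<close> to zero gives
  \<open>dera_surplus \<ge> phi (0, 0) - eta \<bullet> C\<close>, and by complementary slackness
  \<open>eta \<bullet> C = eta \<bullet> Cmin\<close>, which vanishes in both cases of the statement.\<close>

lemma inner_vec_nonneg:
  fixes u v :: "real^'n"
  assumes "0 \<le> u" "0 \<le> v"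
  shows "0 \<le> u \<bullet> v"
  using assms by (auto simp: inner_vec_def less_eq_vec_def intro!: sum_nonneg)

lemma matrix_vector_mult_nonneg:
  fixes B :: "real^'n^'m" and v :: "real^'n"
  assumes "\<And>i j. 0 \<le> B $ i $ j" "0 \<le> v"
  shows "0 \<le> B *v v"
  using assms by (auto simp: matrix_vector_mult_def less_eq_vec_def intro!: sum_nonneg)

lemma mat_pos_nonneg: "0 \<le> mat_pos B $ i $ j"
  by (simp add: mat_pos_def pos_part_def)

lemma mat_neg_nonneg: "0 \<le> mat_neg B $ i $ j"
  by (simp add: mat_neg_def neg_part_def pos_part_def)

text \<open>Serves deviations of a single participant in the Lagrangian. It is stated over abelian
  groups because it is applied both to vector sums of access and to real sums of utilities and
  multiplier terms.\<close>

lemma sum_univ_point_change: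
  fixes f g :: "'k::finite \<Rightarrow> 'a::ab_group_add"
  assumes "\<And>j. j \<noteq> k \<Longrightarrow> g j = f j"
  shows "(\<Sum>j\<in>UNIV. g j) = (\<Sum>j\<in>UNIV. f j) - f k + g k"
proof -
  have "(\<Sum>j\<in>UNIV - {k}. g j) = (\<Sum>j\<in>UNIV - {k}. f j)"
    using assms by (intro sum.cong) auto
  then show ?thesis
    by (simp add: sum.remove[of UNIV k])
qed

lemma dso_surplus_nonneg:
  assumes data: "admissible_data R" and opt: "primal_dual_optimal R x y"
  shows "0 \<le> dso_surplus R x y"
proof -
  define S T where "S = (\<Sum>k\<in>UNIV. C_up x k)" and "T = (\<Sum>k\<in>UNIV. C_lo x k)"
  have feas: "feasible R x" and dual: "dual_feasible y"
    and min: "\<And>x'. lagrangian R y x \<le> lagrangian R y x'"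
    using opt by (auto simp: primal_dual_optimal_def)
  have C: "0 \<le> C_up x k" "0 \<le> C_lo x k" for k
    using data feas unfolding admissible_data_def feasible_def by (meson order_trans)+
  have ST: "0 \<le> S" "0 \<le> T"
    unfolding S_def T_def using C by (auto simp: less_eq_vec_def intro!: sum_nonneg)
  have P: "P_up x = S + p0_up R" "P_lo x = T + p0_lo R"
    using feas by (auto simp: feasible_def S_def T_def)
  have pay: "(\<Sum>k\<in>UNIV. payment x y k) = lam_up y \<bullet> S + lam_lo y \<bullet> T"
    by (simp add: payment_def S_def T_def sum.distrib inner_sum_right)
  note mv = matrix_vector_mult_nonneg[OF mat_pos_nonneg] matrix_vector_mult_nonneg[OF mat_neg_nonneg]
  \<comment> \<open>By linearity, these six terms are the drop in the network and capacity terms of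
    the Lagrangian when \<open>P_up x\<close>, \<open>P_lo x\<close> are lowered by
    \<open>S\<close>, \<open>T\<close>.\<close>
  have nn: "0 \<le> mu_up y \<bullet> (mat_pos (Amat R) *v S)" "0 \<le> mu_up y \<bullet> (mat_neg (Amat R) *v T)"
    "0 \<le> mu_lo y \<bullet> (mat_pos (Amat R) *v T)" "0 \<le> mu_lo y \<bullet> (mat_neg (Amat R) *v S)"
    "0 \<le> omega_up y \<bullet> S" "0 \<le> omega_lo y \<bullet> T"
    using dual ST by (auto simp: dual_feasible_def intro!: inner_vec_nonneg mv)
  \<comment> \<open>All access is kept, so the balance equations are off by exactly \<open>S\<close>
    and \<open>T\<close>, and pricing these residuals yields the total payment. Infeasibility is
    harmless: minimality holds over all points.\<close>
  have "lagrangian R y x \<le> lagrangian R y (x\<lparr>P_up := p0_up R, P_lo := p0_lo R\<rparr>)"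
    by (rule min)
  then show ?thesis
    using nn
    by (simp add: lagrangian_def objective_def dso_surplus_def pay P
        flip: S_def T_def)
      (simp add: matrix_vector_right_distrib inner_add_right inner_diff_right)
qed

lemma dera_surplus_ge:
  assumes opt: "primal_dual_optimal R x y"
  shows "phi R k (0, 0) - eta_up y k \<bullet> Cmin_up R k - eta_lo y k \<bullet> Cmin_lo R k
    \<le> dera_surplus R x y k"
proof -
  \<comment> \<open>With \<open>P_up\<close>, \<open>P_lo\<close> fixed, only utility, balance and
    minimum access terms change; the balance terms lose exactly the payment of
    \<open>k\<close>.\<close>
  define x' where "x' = x\<lparr>C_up := (C_up x)(k := 0), C_lo := (C_lo x)(k := 0)\<rparr>"
  have slack: "complementary_slackness R x y"
    and min: "lagrangian R y x \<le> lagrangian R y x'"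
    using opt by (auto simp: primal_dual_optimal_def)
  have "eta_up y k \<bullet> (Cmin_up R k - C_up x k) = 0" "eta_lo y k \<bullet> (Cmin_lo R k - C_lo x k) = 0"
    using slack unfolding complementary_slackness_def inner_vec_def inner_real_def
    by (auto intro!: sum.neutral)
  then have eta: "eta_up y k \<bullet> C_up x k = eta_up y k \<bullet> Cmin_up R k"
    "eta_lo y k \<bullet> C_lo x k = eta_lo y k \<bullet> Cmin_lo R k"
    by (auto simp: inner_diff_right)
  have x': "P_up x' = P_up x" "P_lo x' = P_lo x" "C_up x' k = 0" "C_lo x' k = 0"
    "\<And>j. j \<noteq> k \<Longrightarrow> C_up x' j = C_up x j" "\<And>j. j \<noteq> k \<Longrightarrow> C_lo x' j = C_lo x j"
    by (auto simp: x'_def)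
  have sums:
    "(\<Sum>j\<in>UNIV. C_up x' j) = (\<Sum>j\<in>UNIV. C_up x j) - C_up x k"
    "(\<Sum>j\<in>UNIV. C_lo x' j) = (\<Sum>j\<in>UNIV. C_lo x j) - C_lo x k"
    "(\<Sum>j\<in>UNIV. phi R j (C_lo x' j, C_up x' j)) =
      (\<Sum>j\<in>UNIV. phi R j (C_lo x j, C_up x j)) - phi R k (C_lo x k, C_up x k) + phi R k (0, 0)"
    "(\<Sum>j\<in>UNIV. eta_up y j \<bullet> (Cmin_up R j - C_up x' j)) =
      (\<Sum>j\<in>UNIV. eta_up y j \<bullet> (Cmin_up R j - C_up x j)) + eta_up y k \<bullet> C_up x k"
    "(\<Sum>j\<in>UNIV. eta_lo y j \<bullet> (Cmin_lo R j - C_lo x' j)) =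
      (\<Sum>j\<in>UNIV. eta_lo y j \<bullet> (Cmin_lo R j - C_lo x j)) + eta_lo y k \<bullet> C_lo x k"
    using sum_univ_point_change[of k "C_up x'" "C_up x"] sum_univ_point_change[of k "C_lo x'" "C_lo x"]
      sum_univ_point_change[of k "\<lambda>j. phi R j (C_lo x' j, C_up x' j)" "\<lambda>j. phi R j (C_lo x j, C_up x j)"]
      sum_univ_point_change[of k "\<lambda>j. eta_up y j \<bullet> (Cmin_up R j - C_up x' j)"
        "\<lambda>j. eta_up y j \<bullet> (Cmin_up R j - C_up x j)"]
      sum_univ_point_change[of k "\<lambda>j. eta_lo y j \<bullet> (Cmin_lo R j - C_lo x' j)"
        "\<lambda>j. eta_lo y j \<bullet> (Cmin_lo R j - C_lo x j)"]
    \<comment> \<open>The instances at \<open>k\<close> expand only the isolated summand and leave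
      the sums over \<open>j\<close> intact.\<close>
    by (simp_all add: x' inner_diff_right[of _ "Cmin_up R k"] inner_diff_right[of _ "Cmin_lo R k"])
  show ?thesis
    using min unfolding lagrangian_def objective_def x' sums
    by (simp add: dera_surplus_def payment_def eta inner_add_right inner_diff_right)
qed

theorem proposition2:
  fixes R :: "('m::finite, 'n::finite, 'k::finite) access_problem"
    and x :: "('n, 'k) primal_point"
    and y :: "('m, 'n, 'k) multipliers"
  assumes "admissible_data R"
    and "primal_dual_optimal R x y"
  shows "dso_surplus R x y \<ge> 0 \<and>
    (\<forall>k. phi R k (0, 0) \<ge> 0 \<and>
         ((Cmin_up R k = 0 \<and> Cmin_lo R k = 0) \<or>
          (\<forall>i. C_up x k $ i > Cmin_up R k $ i \<and> C_lo x k $ i > Cmin_lo R k $ i))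
         \<longrightarrow> dera_surplus R x y k \<ge> 0)"
proof (intro conjI allI impI)
  show "dso_surplus R x y \<ge> 0"
    using assms by (rule dso_surplus_nonneg)
next
  fix k
  assume k: "phi R k (0, 0) \<ge> 0 \<and>
         ((Cmin_up R k = 0 \<and> Cmin_lo R k = 0) \<or>
          (\<forall>i. C_up x k $ i > Cmin_up R k $ i \<and> C_lo x k $ i > Cmin_lo R k $ i))"
  have slack: "eta_up y k $ i * (Cmin_up R k - C_up x k) $ i = 0"
    "eta_lo y k $ i * (Cmin_lo R k - C_lo x k) $ i = 0" for i
    using assms(2) by (auto simp: primal_dual_optimal_def complementary_slackness_def)
  \<comment> \<open>If the minima are zero, the final \<open>simp\<close> suffices; if they are
    non-binding, the slack factors are nonzero and force both multipliers to vanish.\<close>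
  have "eta_up y k \<bullet> Cmin_up R k = 0 \<and> eta_lo y k \<bullet> Cmin_lo R k = 0"
    using k
  proof (elim conjE disjE)
    assume nonbinding: "\<forall>i. C_up x k $ i > Cmin_up R k $ i \<and> C_lo x k $ i > Cmin_lo R k $ i"
    have "eta_up y k $ i = 0" "eta_lo y k $ i = 0" for i
      using slack[of i] nonbinding[rule_format, of i] by auto
    then show ?thesis
      by (simp add: inner_vec_def)
  qed simp
  then show "dera_surplus R x y k \<ge> 0"
    using dera_surplus_ge[OF assms(2), of k] k by linarith
qed

end
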